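(* Let $h \in \Gamma_0(\mathbb{R}^N)$ and let $V = D + uu^T$, where $D \in \mathbb{R}^{N\times N}$ is diagonal with strictly positive diagonal elements $d_1,\dots,d_N$ and $u \in \mathbb{R}^N$. Then for every $x \in \mathbb{R}^N$, $$\operatorname{prox}^V_h(x) = D^{-1/2}\,\operatorname{prox}_{h \circ D^{-1/2}}\big(D^{1/2}x - v\big),$$ where $v = \alpha^\star D^{-1/2}u$ and $\alpha^\star \in \mathbb{R}$ is the unique root of the function $p:\mathbb{R}\to\mathbb{R}$ defined by $$p(\alpha) = \Big\langle u,\; x - D^{-1/2}\operatorname{prox}_{h\circ D^{-1/2}}\big(D^{1/2}(x - \alpha D^{-1}u)\big)\Big\rangle + \alpha .$$ Moreover, $p$ is Lipschitz continuous and strictly increasing on $\mathbb{R}$, with Lipschitz constant $1 + \sum_{i=1}^N u_i^2/d_i$.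
   Context: $\mathbb{R}^N$ carries the usual Euclidean scalar product $\langle\cdot,\cdot\rangle$ and norm $\|\cdot\|$. $\Gamma_0(\mathbb{R}^N)$ is the class of proper lower semicontinuous convex functions from $\mathbb{R}^N$ to $\mathbb{R}\cup\{+\infty\}$. For $g\in\Gamma_0(\mathbb{R}^N)$, $\operatorname{prox}_g(x)$ denotes the unique minimizer of $z\mapsto \frac12\|x-z\|^2+g(z)$. For a symmetric positive-definite matrix $V$, $\|x\|_V = \sqrt{\langle x, Vx\rangle}$, and $\operatorname{prox}^V_g(x)$ denotes the unique minimizer of $z\mapsto\frac12\|x-z\|_V^2+g(z)$, equivalently $\operatorname{prox}^V_g = (\mathrm{I}+V^{-1}\partial g)^{-1}$, where $\partial g$ is the (Euclidean) subdifferential. $h\circ D^{-1/2}$ is the function $y\mapsto h(D^{-1/2}y)$. *)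

theory Defs
  imports "HOL-Analysis.Analysis"
begin

definition lower_semicontinuous :: "('a::topological_space \<Rightarrow> ereal) \<Rightarrow> bool"
  where "lower_semicontinuous g \<longleftrightarrow> (\<forall>x. g x \<le> Liminf (at x) g)"

definition proper_fun :: "('a \<Rightarrow> ereal) \<Rightarrow> bool"
  where "proper_fun g \<longleftrightarrow> (\<forall>x. g x \<noteq> -\<infinity>) \<and> (\<exists>x. g x \<noteq> \<infinity>)"

text \<open>The library's \<^const>\<open>convex_on\<close> is for real-valued functions only. At the endpoints
  \<open>t = 0\<close> and \<open>t = 1\<close> the convention \<open>0 * \<infinity> = 0\<close> makes the inequality trivial.\<close>

definition convex_ereal :: "('a::real_vector \<Rightarrow> ereal) \<Rightarrow> bool"
  where "convex_ereal g \<longleftrightarrow>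
    (\<forall>x y. \<forall>t\<in>{0..1}. g ((1 - t) *\<^sub>R x + t *\<^sub>R y) \<le> ereal (1 - t) * g x + ereal t * g y)"

definition Gamma0 :: "('a::real_normed_vector \<Rightarrow> ereal) set"
  where "Gamma0 = {g. proper_fun g \<and> lower_semicontinuous g \<and> convex_ereal g}"

definition prox :: "('a::real_normed_vector \<Rightarrow> ereal) \<Rightarrow> 'a \<Rightarrow> 'a"
  where "prox g x =
    (THE z. is_arg_min (\<lambda>z. ereal (1/2 * (norm (x - z))\<^sup>2) + g z) (\<lambda>_. True) z)"

definition norm_mat :: "real^'n^'n \<Rightarrow> real^'n \<Rightarrow> real"
  where "norm_mat V x = sqrt (x \<bullet> (V *v x))"

definition prox_mat :: "real^'n^'n \<Rightarrow> (real^'n \<Rightarrow> ereal) \<Rightarrow> real^'n \<Rightarrow> real^'n"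
  where "prox_mat V g x =
    (THE z. is_arg_min (\<lambda>z. ereal (1/2 * (norm_mat V (x - z))\<^sup>2) + g z) (\<lambda>_. True) z)"

text \<open>The real power \<open>D\<^sup>s\<close> of a diagonal matrix with positive diagonal; off-diagonal entries
  of the argument are ignored.\<close>

definition diag_powr :: "real^'n^'n \<Rightarrow> real \<Rightarrow> real^'n^'n"
  where "diag_powr D s = (\<chi> i j. if i = j then (D $ i $ i) powr s else 0)"

lemma diag_powr_add: "diag_powr D s ** diag_powr D t = diag_powr D (s + t)"
proof -
  have "(diag_powr D s ** diag_powr D t) $ i $ j = diag_powr D (s + t) $ i $ j" for i j
  proof -
    have "(diag_powr D s ** diag_powr D t) $ i $ j
        = (\<Sum>k\<in>UNIV. if k = i then (D $ i $ i) powr s * diag_powr D t $ i $ j else 0)"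
      unfolding matrix_matrix_mult_def vec_lambda_beta
      by (rule sum.cong) (auto simp: diag_powr_def)
    also have "\<dots> = diag_powr D (s + t) $ i $ j"
      by (simp add: diag_powr_def powr_add)
    finally show ?thesis .
  qed
  then show ?thesis by (simp add: vec_eq_iff)
qed

lemma diag_powr_1:
  assumes "\<And>i j. i \<noteq> j \<Longrightarrow> D $ i $ j = 0" and "\<And>i. D $ i $ i > 0"
  shows "diag_powr D 1 = D"
  using assms by (simp add: diag_powr_def vec_eq_iff order.strict_implies_order)

lemma diag_powr_0:
  assumes "\<And>i. D $ i $ i > 0"
  shows "diag_powr D 0 = mat 1"
  using assms by (simp add: diag_powr_def mat_def vec_eq_iff order.strict_implies_not_eq[symmetric])

text \<open>The function \<open>p\<close> whose root is sought.\<close>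

definition root_fun ::
    "(real^'n \<Rightarrow> ereal) \<Rightarrow> real^'n^'n \<Rightarrow> real^'n \<Rightarrow> real^'n \<Rightarrow> real \<Rightarrow> real"
  where "root_fun h D u x \<alpha> =
    u \<bullet> (x - diag_powr D (-1/2) *v
           prox (h \<circ> (*v) (diag_powr D (-1/2)))
             (diag_powr D (1/2) *v (x - \<alpha> *\<^sub>R (matrix_inv D *v u)))) + \<alpha>"

end

theory Submission
  imports Defs
begin

text \<open>
  A point \<open>z\<close> minimizes \<open>\<langle>x - z, A (x - z)\<rangle> / 2 + g z\<close>, with \<open>A\<close> symmetric positive definite and
  \<open>g\<close> proper convex, exactly when \<open>A (x - z)\<close> is a subgradient of \<open>g\<close> at \<open>z\<close>. Both directions are
  elementary: expand the quadratic around \<open>z\<close> (\<open>subgradient_imp_unique_minimizer\<close>), or compare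
  \<open>z\<close> with nearby points of a segment (\<open>minimizer_imp_subgradient\<close>, for \<open>A = I\<close>).
  If \<open>A = I\<close> and \<open>g\<close> is also lower semicontinuous, a minimizer exists, because \<open>g\<close> has a minorant
  that decreases at most linearly and a lower semicontinuous function attains its minimum on a
  compact set (\<open>Gamma0_prox_objective_attains_min\<close>). Hence the
  proximity operator \<open>P\<close> of \<open>h \<circ> D\<^sup>-\<^sup>1\<^sup>/\<^sup>2\<close> is characterized by its subgradient inequality, and adding
  two such inequalities makes it firmly nonexpansive (\<open>prox_firmly_nonexpansive\<close>).

  Write \<open>w = D\<^sup>-\<^sup>1\<^sup>/\<^sup>2 u\<close>. The root function is
  \<open>p \<alpha> = \<langle>u, x\<rangle> - \<langle>w, P (D\<^sup>1\<^sup>/\<^sup>2 x - \<alpha> w)\<rangle> + \<alpha>\<close>. Monotonicity of \<open>P\<close> along the direction \<open>w\<close> shows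
  that \<open>p\<close> has slope at least \<open>1\<close>, so that it is strictly increasing and changes sign;
  nonexpansiveness of \<open>P\<close> bounds the slope by \<open>1 + \<parallel>w\<parallel>\<^sup>2\<close>, and \<open>\<parallel>w\<parallel>\<^sup>2 = \<Sum>i. u\<^sub>i\<^sup>2 / d\<^sub>i\<close>. Continuity
  then yields the unique root.

  Finally let \<open>z = D\<^sup>-\<^sup>1\<^sup>/\<^sup>2 P (D\<^sup>1\<^sup>/\<^sup>2 x - \<alpha> w)\<close>. Undoing the change of variables, \<open>D (x - z) - \<alpha> u\<close>
  is a subgradient of \<open>h\<close> at \<open>z\<close>. The optimality condition for the metric \<open>V = D + u u\<^sup>T\<close> asks for the
  subgradient \<open>D (x - z) + \<langle>u, x - z\<rangle> u\<close> instead; the two agree if \<open>\<langle>u, x - z\<rangle> + \<alpha> = 0\<close>,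
  that is, if \<open>p \<alpha> = 0\<close> (\<open>prox_mat_rank_one_update\<close>).
\<close>

section \<open>Lower semicontinuity\<close>

text \<open>The superlevel form is the one that passes to continuous preimages and, through closed
  sublevel sets, to compactness arguments. The limit inferior ignores the value at the point itself,
  but that value exceeds \<open>a\<close> by choice of the point.\<close>

lemma lower_semicontinuous_iff_open_superlevel:
  "lower_semicontinuous g \<longleftrightarrow> (\<forall>a. open {x. a < g x})"
proof
  assume lsc: "lower_semicontinuous g"
  show "\<forall>a. open {x. a < g x}"
  proof
    fix a
    have "\<exists>T. open T \<and> x \<in> T \<and> T \<subseteq> {x. a < g x}" if ax: "a < g x" for x
    proof -
      have "\<forall>\<^sub>F z in at x. a < g z"
        using lsc ax unfolding lower_semicontinuous_def le_Liminf_iff by blast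
      then obtain T where "open T" "x \<in> T" "\<And>z. z \<in> T \<Longrightarrow> z \<noteq> x \<Longrightarrow> a < g z"
        unfolding eventually_at_topological by blast
      with ax show ?thesis by blast
    qed
    then show "open {x. a < g x}"
      by (subst open_subopen) blast
  qed
next
  assume op: "\<forall>a. open {x. a < g x}"
  show "lower_semicontinuous g"
    unfolding lower_semicontinuous_def le_Liminf_iff eventually_at_topological
    using op by blast
qed

lemma lower_semicontinuous_compose:
  assumes "lower_semicontinuous g" "continuous_on UNIV f"
  shows "lower_semicontinuous (g \<circ> f)"
proof -
  have "open (f -` {x. a < g x})" for a
    using assms(1) by (intro open_vimage[OF _ assms(2)])
      (simp add: lower_semicontinuous_iff_open_superlevel)
  then show ?thesis
    by (simp add: lower_semicontinuous_iff_open_superlevel vimage_def)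
qed

lemma lower_semicontinuous_add_continuous:
  fixes q :: "'a::topological_space \<Rightarrow> real"
  assumes g: "lower_semicontinuous g" and q: "continuous_on UNIV q"
  shows "lower_semicontinuous (\<lambda>x. ereal (q x) + g x)"
proof -
  have "open {x. a < ereal (q x) + g x}" for a
  proof -
    \<comment> \<open>A real threshold between \<open>a - q x\<close> and \<open>g x\<close> splits the condition on the sum into one
      condition on each summand.\<close>
    have "\<exists>r. a < ereal (q x + r) \<and> ereal r < g x" if ax: "a < ereal (q x) + g x" for x
    proof -
      have "a - ereal (q x) < g x"
        using ax by (cases a; cases "g x") auto
      then obtain r where "a - ereal (q x) < ereal r" "ereal r < g x"
        using ereal_dense2 by blast
      then have "a < ereal (q x + r)"
        by (cases a) auto
      with \<open>ereal r < g x\<close> show ?thesis by blast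
    qed
    moreover have "a < ereal (q x) + g x" if "a < ereal (q x + r)" "ereal r < g x" for r x
      using that by (cases a; cases "g x") auto
    ultimately have "{x. a < ereal (q x) + g x} =
        (\<Union>r. {x. a < ereal (q x + r)} \<inter> {x. ereal r < g x})"
      by blast
    moreover have "open {x. a < ereal (q x + r)}" for r
      by (intro open_Collect_less continuous_intros continuous_on_ereal q)
    ultimately show ?thesis
      using g by (simp add: lower_semicontinuous_iff_open_superlevel open_UN open_Int)
  qed
  then show ?thesis
    by (simp add: lower_semicontinuous_iff_open_superlevel)
qed

text \<open>The minimizers are the points of \<open>K\<close> common to the closed sublevel sets at the levels
  attained on \<open>K\<close>; any finitely many of these sets meet inside \<open>K\<close>, because the lowest level is attained.\<close>

lemma lower_semicontinuous_attains_min: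
  fixes g :: "'a::t2_space \<Rightarrow> ereal"
  assumes lsc: "lower_semicontinuous g" and K: "compact K" "K \<noteq> {}"
  shows "\<exists>z\<in>K. \<forall>w\<in>K. g z \<le> g w"
proof -
  have closed: "closed {z. g z \<le> a}" for a
    using lsc by (simp add: lower_semicontinuous_iff_open_superlevel closed_def Compl_eq not_le)
  have "K \<inter> (\<Inter>w\<in>K. {z. g z \<le> g w}) \<noteq> {}"
  proof (rule compact_imp_fip_image[OF K(1)])
    fix I assume I: "finite I" "I \<subseteq> K"
    show "K \<inter> (\<Inter>w\<in>I. {z. g z \<le> g w}) \<noteq> {}"
    proof (cases "I = {}")
      case False
      then obtain z where "is_arg_min g (\<lambda>z. z \<in> I) z"
        using ex_is_arg_min_if_finite[OF I(1)] by blast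
      then have "z \<in> K \<inter> (\<Inter>w\<in>I. {z. g z \<le> g w})"
        using I by (auto simp: is_arg_min_linorder)
      then show ?thesis by blast
    qed (use K in auto)
  qed (rule closed)
  then show ?thesis by blast
qed

section \<open>Minimizers of a convex function plus a positive definite quadratic\<close>

text \<open>The subgradient inequality at \<open>z\<close> and the expansion of the quadratic around \<open>z\<close> add up to
  \<open>F w \<ge> F z + \<langle>w - z, A (w - z)\<rangle> / 2\<close> for the objective \<open>F\<close>; the excess is positive for
  \<open>w \<noteq> z\<close>, which gives minimality and uniqueness at once.\<close>

lemma subgradient_imp_unique_minimizer:
  fixes A :: "'a::real_inner \<Rightarrow> 'a"
  assumes A: "linear A" and sym: "\<And>a b. A a \<bullet> b = a \<bullet> A b"
    and pos: "\<And>a. a \<noteq> 0 \<Longrightarrow> a \<bullet> A a > 0"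
    and fin: "\<bar>g z\<bar> \<noteq> \<infinity>"
    and sub: "\<And>w. g z + ereal (A (x - z) \<bullet> (w - z)) \<le> g w"
  shows "(THE z. is_arg_min (\<lambda>z. ereal (1/2 * ((x - z) \<bullet> A (x - z))) + g z) (\<lambda>_. True) z) = z"
proof -
  let ?F = "\<lambda>z. ereal (1/2 * ((x - z) \<bullet> A (x - z))) + g z"
  have less: "?F z < ?F w" if "w \<noteq> z" for w
  proof -
    obtain c where c: "g z = ereal c" using fin by (cases "g z") auto
    have "(x - w) \<bullet> A (x - w) = ((x - z) - (w - z)) \<bullet> A ((x - z) - (w - z))"
      by simp
    also have "\<dots> = (x - z) \<bullet> A (x - z) - 2 * (A (x - z) \<bullet> (w - z)) + (w - z) \<bullet> A (w - z)"
      unfolding linear_diff[OF A, of "x - z" "w - z"]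
      using sym[of "w - z" "x - z"] sym[of "x - z" "w - z"]
      by (simp add: inner_diff_left inner_diff_right inner_commute)
    finally have "1/2 * ((x - z) \<bullet> A (x - z)) < 1/2 * ((x - w) \<bullet> A (x - w)) + A (x - z) \<bullet> (w - z)"
      using pos[of "w - z"] that by (simp only: right_minus_eq) argo
    then show ?thesis
      using sub[of w] c by (cases "g w") auto
  qed
  show ?thesis
  proof (rule the_equality)
    show "is_arg_min ?F (\<lambda>_. True) z"
      unfolding is_arg_min_def using less by (metis less_asym less_irrefl)
    show "z' = z" if "is_arg_min ?F (\<lambda>_. True) z'" for z'
      using that less unfolding is_arg_min_def by blast
  qed
qed

text \<open>Compare \<open>z\<close> with the points \<open>z + t (w - z)\<close>: after division by \<open>t\<close> the quadratic
  contributes only its derivative and a term of order \<open>t\<close>, which vanishes as \<open>t\<close> tends to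
  \<open>0\<close>.\<close>

lemma minimizer_imp_subgradient:
  fixes g :: "'a::real_inner \<Rightarrow> ereal"
  assumes conv: "convex_ereal g" and proper: "proper_fun g"
    and min: "\<And>w. ereal (1/2 * (norm (y - z))\<^sup>2) + g z \<le> ereal (1/2 * (norm (y - w))\<^sup>2) + g w"
  shows "\<bar>g z\<bar> \<noteq> \<infinity>" and "g z + ereal ((y - z) \<bullet> (w - z)) \<le> g w"
proof -
  have ninf: "g w \<noteq> -\<infinity>" for w using proper by (auto simp: proper_fun_def)
  obtain x0 where "g x0 \<noteq> \<infinity>" using proper by (auto simp: proper_fun_def)
  then show fin: "\<bar>g z\<bar> \<noteq> \<infinity>"
    using min[of x0] ninf[of z] ninf[of x0] by (cases "g z"; cases "g x0") auto
  then obtain c where c: "g z = ereal c" by (cases "g z") auto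
  show "g z + ereal ((y - z) \<bullet> (w - z)) \<le> g w"
  proof (cases "g w")
    case (real b)
    define i where "i = (y - z) \<bullet> (w - z)"
    define n where "n = (norm (w - z))\<^sup>2"
    have step: "c + i \<le> b + t / 2 * n" if t: "0 < t" "t < 1" for t
    proof -
      let ?p = "(1 - t) *\<^sub>R z + t *\<^sub>R w"
      have "g ?p \<le> ereal (1 - t) * g z + ereal t * g w"
        using conv t by (auto simp: convex_ereal_def)
      then have gp: "g ?p \<le> ereal ((1 - t) * c + t * b)"
        by (simp add: c real)
      have "y - ?p = (y - z) - t *\<^sub>R (w - z)" by (simp add: algebra_simps)
      then have "(norm (y - ?p))\<^sup>2 = (norm (y - z))\<^sup>2 - 2 * t * i + t * t * n"
        unfolding i_def n_def
        by (simp only: power2_norm_eq_inner)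
          (simp add: inner_diff_left inner_diff_right inner_commute algebra_simps)
      then have "t * (c + i) \<le> t * (b + t / 2 * n)"
        using min[of ?p] gp by (cases "g ?p") (auto simp: c algebra_simps)
      then show ?thesis using t by simp
    qed
    have "((\<lambda>t. b + t / 2 * n) \<longlongrightarrow> b + 0 / 2 * n) (at_right 0)"
      by (intro tendsto_intros) simp
    moreover have "\<forall>\<^sub>F t::real in at_right 0. c + i \<le> b + t / 2 * n"
      using step by (auto simp: eventually_at_right_field intro!: exI[of _ 1])
    ultimately have "c + i \<le> b + 0 / 2 * n"
      by (intro tendsto_lowerbound[where F = "at_right (0::real)"]) auto
    then show ?thesis by (simp add: c real i_def)
  qed (use ninf in auto)
qed

section \<open>The proximity operator\<close>

text \<open>Lower semicontinuity bounds \<open>g\<close> below on the unit ball around a point \<open>x\<^sub>0\<close> of its domain;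
  by convexity along rays from \<open>x\<^sub>0\<close>, this bound extends to the whole space at the price of a term
  that grows linearly.\<close>

lemma Gamma0_linear_minorant:
  fixes g :: "'a::euclidean_space \<Rightarrow> ereal"
  assumes g: "g \<in> Gamma0" and x0: "g x0 = ereal c"
  obtains k where "k \<ge> 0" "\<And>z. ereal (c - k - k * norm (z - x0)) \<le> g z"
proof -
  have ninf: "g w \<noteq> -\<infinity>" for w using g by (auto simp: Gamma0_def proper_fun_def)
  obtain z1 where z1: "z1 \<in> cball x0 1" "\<And>w. w \<in> cball x0 1 \<Longrightarrow> g z1 \<le> g w"
    using lower_semicontinuous_attains_min[of g "cball x0 1"] g by (auto simp: Gamma0_def)
  have "g z1 \<le> ereal c" using z1(2)[of x0] x0 by simp
  then obtain m where m: "g z1 = ereal m" "m \<le> c"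
    using ninf[of z1] by (cases "g z1") auto
  have "ereal (c - (c - m) - (c - m) * norm (z - x0)) \<le> g z" for z
  proof (cases "norm (z - x0) \<le> 1")
    case True
    then have "ereal m \<le> g z"
      using z1(2)[of z] m by (simp add: dist_norm norm_minus_commute)
    moreover have "(c - m) * norm (z - x0) \<ge> 0" using m by simp
    ultimately show ?thesis by (cases "g z") auto
  next
    case False
    define r where "r = norm (z - x0)"
    define t where "t = 1 / r"
    have r: "r > 1" using False by (simp add: r_def)
    then have t: "0 < t" "t < 1" "r * t = 1" by (auto simp: t_def)
    let ?p = "(1 - t) *\<^sub>R x0 + t *\<^sub>R z"
    have "?p - x0 = t *\<^sub>R (z - x0)" by (simp add: algebra_simps)
    then have "norm (?p - x0) = 1" using t by (simp add: r_def[symmetric] mult.commute)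
    then have "ereal m \<le> g ?p"
      using z1(2)[of ?p] m by (simp add: dist_norm norm_minus_commute)
    also have "g ?p \<le> ereal (1 - t) * g x0 + ereal t * g z"
      using g t by (auto simp: Gamma0_def convex_ereal_def)
    finally have *: "ereal m \<le> ereal (1 - t) * ereal c + ereal t * g z" by (simp add: x0)
    show ?thesis
    proof (cases "g z")
      case (real b)
      have "m \<le> (1 - t) * c + t * b" using * real by simp
      then have "r * m \<le> r * ((1 - t) * c + t * b)" using r by simp
      also have "\<dots> = r * c - (r * t) * c + (r * t) * b" by (simp add: algebra_simps)
      finally have "r * m \<le> r * c - c + b" using t by simp
      then show ?thesis using m by (simp add: real r_def[symmetric] algebra_simps)
    qed (use ninf in auto)
  qed
  then show ?thesis using m by (intro that[of "c - m"]) auto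
qed

text \<open>The quadratic outgrows the linear decrease of the minorant, so outside a large ball the
  objective is larger than at the center, and the minimum over the ball is global.\<close>

lemma Gamma0_prox_objective_attains_min:
  fixes g :: "'a::euclidean_space \<Rightarrow> ereal"
  assumes g: "g \<in> Gamma0"
  shows "\<exists>z. \<forall>w. ereal (1/2 * (norm (y - z))\<^sup>2) + g z \<le> ereal (1/2 * (norm (y - w))\<^sup>2) + g w"
proof -
  let ?F = "\<lambda>z. ereal (1/2 * (norm (y - z))\<^sup>2) + g z"
  obtain x0 c where x0: "g x0 = ereal c"
  proof -
    obtain x0 where "g x0 \<noteq> \<infinity>" "g x0 \<noteq> -\<infinity>"
      using g by (auto simp: Gamma0_def proper_fun_def)
    then show ?thesis using that by (cases "g x0") auto
  qed
  obtain k where k: "k \<ge> 0" "\<And>z. ereal (c - k - k * norm (z - x0)) \<le> g z"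
    using Gamma0_linear_minorant[OF g x0] by blast
  define s where "s = norm (y - x0)"
  \<comment> \<open>At distance \<open>r\<close> from \<open>x\<^sub>0\<close> the objective exceeds its value at \<open>x\<^sub>0\<close> by at least
    \<open>r (r / 2 - s - k) - k\<close>, which is positive for \<open>r > R\<close>.\<close>
  define R where "R = 2 * (s + k + 1)"
  have s: "s \<ge> 0" by (simp add: s_def)
  have "lower_semicontinuous ?F"
    using g by (intro lower_semicontinuous_add_continuous continuous_intros) (auto simp: Gamma0_def)
  moreover have "R \<ge> 0" using s k by (simp add: R_def)
  then have "cball x0 R \<noteq> {}" by simp
  ultimately obtain z where z: "\<And>w. w \<in> cball x0 R \<Longrightarrow> ?F z \<le> ?F w"
    using lower_semicontinuous_attains_min[of ?F "cball x0 R"] compact_cball by blast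
  have "?F z \<le> ?F w" for w
  proof (cases "w \<in> cball x0 R")
    case False
    define r where "r = norm (w - x0)"
    have r: "r > R" using False by (simp add: r_def dist_norm norm_minus_commute)
    have "r \<le> norm (y - w) + s"
      using norm_triangle_ineq4[of "y - x0" "y - w"] by (simp add: r_def s_def)
    then have "(r - s)\<^sup>2 \<le> (norm (y - w))\<^sup>2"
      using r s k by (intro power_mono) (auto simp: R_def)
    moreover have "r * 1 \<le> r * (r / 2 - s - k)"
      using r s k by (intro mult_left_mono) (auto simp: R_def)
    ultimately have "1/2 * s\<^sup>2 + c \<le> 1/2 * (norm (y - w))\<^sup>2 + (c - k - k * r)"
      using r s k by (simp add: R_def power2_eq_square algebra_simps)
    then have "?F x0 \<le> ?F w"
      using k(2)[of w] by (cases "g w") (auto simp: x0 s_def r_def)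
    moreover have "?F z \<le> ?F x0" using z \<open>R \<ge> 0\<close> by simp
    ultimately show ?thesis by (rule order_trans[rotated])
  qed (use z in auto)
  then show ?thesis by blast
qed

lemma prox_subgradient:
  fixes g :: "'a::euclidean_space \<Rightarrow> ereal"
  assumes g: "g \<in> Gamma0"
  shows "\<bar>g (prox g y)\<bar> \<noteq> \<infinity>"
    and "g (prox g y) + ereal ((y - prox g y) \<bullet> (w - prox g y)) \<le> g w"
proof -
  obtain z where z: "\<And>w. ereal (1/2 * (norm (y - z))\<^sup>2) + g z \<le> ereal (1/2 * (norm (y - w))\<^sup>2) + g w"
    using Gamma0_prox_objective_attains_min[OF g] by blast
  have "convex_ereal g" "proper_fun g" using g by (auto simp: Gamma0_def)
  note sub = minimizer_imp_subgradient[OF this z]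
  have "prox g y = z"
    unfolding prox_def power2_norm_eq_inner
    by (rule subgradient_imp_unique_minimizer[where A = "\<lambda>a. a", OF linear_ident])
      (use sub in auto)
  then show "\<bar>g (prox g y)\<bar> \<noteq> \<infinity>"
    and "g (prox g y) + ereal ((y - prox g y) \<bullet> (w - prox g y)) \<le> g w"
    using sub by auto
qed

text \<open>Add the subgradient inequalities at the two proximal points, each tested at the other.\<close>

lemma prox_firmly_nonexpansive:
  fixes g :: "'a::euclidean_space \<Rightarrow> ereal"
  assumes g: "g \<in> Gamma0"
  shows "(norm (prox g a - prox g b))\<^sup>2 \<le> (prox g a - prox g b) \<bullet> (a - b)"
proof -
  obtain ca cb where c: "g (prox g a) = ereal ca" "g (prox g b) = ereal cb"
    using prox_subgradient(1)[OF g] by (metis ereal_cases abs_ereal.simps(2,3))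
  have "ca + (a - prox g a) \<bullet> (prox g b - prox g a) \<le> cb"
    "cb + (b - prox g b) \<bullet> (prox g a - prox g b) \<le> ca"
    using prox_subgradient(2)[OF g, of a "prox g b"] prox_subgradient(2)[OF g, of b "prox g a"]
    by (auto simp: c)
  then show ?thesis
    by (simp add: power2_norm_eq_inner inner_diff_left inner_diff_right inner_commute)
qed

lemma prox_nonexpansive:
  fixes g :: "'a::euclidean_space \<Rightarrow> ereal"
  assumes "g \<in> Gamma0"
  shows "norm (prox g a - prox g b) \<le> norm (a - b)"
proof (cases "prox g a = prox g b")
  case False
  have "norm (prox g a - prox g b) * norm (prox g a - prox g b)
      \<le> norm (prox g a - prox g b) * norm (a - b)"
    using prox_firmly_nonexpansive[OF assms, of a b]
      norm_cauchy_schwarz[of "prox g a - prox g b" "a - b"]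
    by (simp add: power2_eq_square)
  then show ?thesis using False by simp
qed simp

lemma Gamma0_compose_linear_surj:
  fixes h :: "'b::real_normed_vector \<Rightarrow> ereal" and f :: "'a::euclidean_space \<Rightarrow> 'b"
  assumes h: "h \<in> Gamma0" and f: "linear f" "surj f"
  shows "h \<circ> f \<in> Gamma0"
proof -
  have "proper_fun (h \<circ> f)"
    using h f(2) unfolding Gamma0_def proper_fun_def by (auto, metis surjD)
  moreover have "lower_semicontinuous (h \<circ> f)"
    using h f(1) by (intro lower_semicontinuous_compose linear_continuous_on)
      (auto simp: Gamma0_def linear_conv_bounded_linear)
  moreover have "convex_ereal (h \<circ> f)"
    using h by (simp add: Gamma0_def convex_ereal_def linear_add[OF f(1)] linear_scale[OF f(1)])
  ultimately show ?thesis by (simp add: Gamma0_def)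
qed

section \<open>Diagonal matrices and rank-one updates\<close>

lemma diag_powr_mult_vec: "diag_powr D s *v z = (\<chi> i. (D $ i $ i) powr s * z $ i)"
  by (simp add: vec_eq_iff diag_powr_def matrix_vector_mult_def
      if_distrib[where f = "\<lambda>a. a * _"] cong: if_cong)

lemma diag_powr_inner: "(diag_powr D s *v a) \<bullet> b = a \<bullet> (diag_powr D s *v b)"
  by (simp add: diag_powr_mult_vec inner_vec_def mult_ac)

lemma matrix_inv_diag:
  assumes "\<And>i j. i \<noteq> j \<Longrightarrow> D $ i $ j = 0" and "\<And>i. D $ i $ i > 0"
  shows "matrix_inv D = diag_powr D (-1)"
proof -
  let ?E = "diag_powr D (-1)"
  have "D ** ?E = mat 1"
    using diag_powr_add[of D 1 "-1"] diag_powr_1[OF assms] diag_powr_0[OF assms(2)] by simp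
  then have ED: "?E ** D = mat 1" using matrix_left_right_inverse by blast
  have "\<exists>A. D ** A = mat 1 \<and> A ** D = mat 1"
    using \<open>D ** ?E = mat 1\<close> ED by blast
  from someI_ex[OF this] have "D ** matrix_inv D = mat 1"
    by (simp add: matrix_inv_def)
  then have "?E ** (D ** matrix_inv D) = ?E" by simp
  then show ?thesis by (simp add: matrix_mul_assoc ED)
qed

lemma rank_one_update_mult_vec:
  fixes u :: "real^'n"
  shows "(D + (columnvector u :: real^1^'n) ** rowvector u) *v z = D *v z + (u \<bullet> z) *\<^sub>R u"
  by (simp add: vec_eq_iff matrix_vector_mult_def matrix_matrix_mult_def columnvector_def
      rowvector_def inner_vec_def distrib_right distrib_left sum.distrib sum_distrib_left mult_ac)

section \<open>The root function and the scaled proximity operator\<close>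

context
  fixes h :: "real^'n \<Rightarrow> ereal" and D :: "real^'n^'n" and u x :: "real^'n"
  assumes h: "h \<in> Gamma0"
    and off_diag: "\<And>i j. i \<noteq> j \<Longrightarrow> D $ i $ j = 0"
    and diag_pos: "\<And>i. D $ i $ i > 0"
begin

lemma diag_powr_cancel:
  "diag_powr D (-1/2) *v (diag_powr D (1/2) *v z) = z"
  "diag_powr D (1/2) *v (diag_powr D (-1/2) *v z) = z"
  using diag_pos
  by (simp_all add: matrix_vector_mul_assoc diag_powr_add diag_powr_0)

lemma diag_powr_half_half: "diag_powr D (1/2) *v (diag_powr D (1/2) *v z) = D *v z"
  using off_diag diag_pos by (simp add: matrix_vector_mul_assoc diag_powr_add diag_powr_1)

lemma Gamma0_rescaled: "h \<circ> (*v) (diag_powr D (-1/2)) \<in> Gamma0"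
proof (rule Gamma0_compose_linear_surj[OF h])
  show "surj ((*v) (diag_powr D (-1/2)))"
    using diag_powr_cancel(1) by (rule surjI)
qed (rule matrix_vector_mul_linear)

lemma rescaled_shift:
  "diag_powr D (1/2) *v (x - \<alpha> *\<^sub>R (matrix_inv D *v u))
    = diag_powr D (1/2) *v x - \<alpha> *\<^sub>R (diag_powr D (-1/2) *v u)"
proof -
  have "diag_powr D (1/2) *v (matrix_inv D *v u) = diag_powr D (-1/2) *v u"
    using matrix_inv_diag[OF off_diag diag_pos]
    by (simp add: matrix_vector_mul_assoc diag_powr_add)
  then show ?thesis
    by (simp add: matrix_vector_mult_diff_distrib matrix_vector_mult_scaleR)
qed

text \<open>With \<open>w = D\<^sup>-\<^sup>1\<^sup>/\<^sup>2 u\<close>, moving the symmetric matrix to the other side of the inner product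
  turns the root function into an affine function of the proximal point on the line
  \<open>D\<^sup>1\<^sup>/\<^sup>2 x - \<alpha> w\<close>, with the line's own direction \<open>w\<close> as the coefficient.\<close>

lemma root_fun_eq:
  "root_fun h D u x \<alpha> = u \<bullet> x
    - (diag_powr D (-1/2) *v u) \<bullet> prox (h \<circ> (*v) (diag_powr D (-1/2)))
        (diag_powr D (1/2) *v x - \<alpha> *\<^sub>R (diag_powr D (-1/2) *v u)) + \<alpha>"
  by (simp add: root_fun_def rescaled_shift inner_diff_right diag_powr_inner)

text \<open>Monotonicity of the proximity operator along the line makes the inner product in
  \<open>root_fun_eq\<close> nonincreasing, so the summand \<open>\<alpha>\<close> alone gives slope at least \<open>1\<close>.\<close>

lemma root_fun_slope_ge_1:
  assumes "\<alpha> \<le> \<beta>"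
  shows "\<beta> - \<alpha> \<le> root_fun h D u x \<beta> - root_fun h D u x \<alpha>"
proof (cases "\<alpha> = \<beta>")
  case False
  define w where "w = diag_powr D (-1/2) *v u"
  define P where "P \<alpha> = prox (h \<circ> (*v) (diag_powr D (-1/2))) (diag_powr D (1/2) *v x - \<alpha> *\<^sub>R w)" for \<alpha>
  have "0 \<le> (norm (P \<alpha> - P \<beta>))\<^sup>2" by simp
  also have "\<dots> \<le> (P \<alpha> - P \<beta>) \<bullet> ((\<beta> - \<alpha>) *\<^sub>R w)"
    using prox_firmly_nonexpansive[OF Gamma0_rescaled,
        of "diag_powr D (1/2) *v x - \<alpha> *\<^sub>R w" "diag_powr D (1/2) *v x - \<beta> *\<^sub>R w"]
    by (simp add: P_def scaleR_diff_left)
  finally have "w \<bullet> P \<beta> \<le> w \<bullet> P \<alpha>"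
    using assms False by (simp add: inner_diff_right inner_commute zero_le_mult_iff)
  then show ?thesis
    unfolding root_fun_eq w_def[symmetric] P_def[symmetric] by simp
qed simp

lemma strict_mono_root_fun: "strict_mono (root_fun h D u x)"
proof (rule strict_monoI)
  show "root_fun h D u x \<alpha> < root_fun h D u x \<beta>" if "\<alpha> < \<beta>" for \<alpha> \<beta>
    using root_fun_slope_ge_1[of \<alpha> \<beta>] that by simp
qed

lemma norm_diag_powr_neg_half:
  "(norm (diag_powr D (-1/2) *v u))\<^sup>2 = (\<Sum>i\<in>UNIV. (u $ i)\<^sup>2 / D $ i $ i)"
proof -
  have "(norm (diag_powr D (-1/2) *v u))\<^sup>2 = u \<bullet> (diag_powr D (-1) *v u)"
    by (simp add: power2_norm_eq_inner diag_powr_inner matrix_vector_mul_assoc diag_powr_add)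
  also have "\<dots> = (\<Sum>i\<in>UNIV. (u $ i)\<^sup>2 / D $ i $ i)"
    unfolding inner_vec_def diag_powr_mult_vec
    by (rule sum.cong)
      (simp_all add: powr_minus_divide less_imp_le[OF diag_pos] power2_eq_square)
  finally show ?thesis .
qed

lemma lipschitz_root_fun:
  "(1 + (\<Sum>i\<in>UNIV. (u $ i)\<^sup>2 / D $ i $ i))-lipschitz_on UNIV (root_fun h D u x)"
proof (rule lipschitz_onI)
  fix \<alpha> \<beta> :: real
  define w where "w = diag_powr D (-1/2) *v u"
  define P where "P \<alpha> = prox (h \<circ> (*v) (diag_powr D (-1/2))) (diag_powr D (1/2) *v x - \<alpha> *\<^sub>R w)" for \<alpha>
  have "norm (P \<beta> - P \<alpha>) \<le> norm ((\<alpha> - \<beta>) *\<^sub>R w)"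
    using prox_nonexpansive[OF Gamma0_rescaled,
        of "diag_powr D (1/2) *v x - \<beta> *\<^sub>R w" "diag_powr D (1/2) *v x - \<alpha> *\<^sub>R w"]
    by (simp add: P_def scaleR_diff_left)
  then have "norm w * norm (P \<beta> - P \<alpha>) \<le> norm w * (\<bar>\<alpha> - \<beta>\<bar> * norm w)"
    by (simp add: mult_left_mono)
  then have "\<bar>w \<bullet> (P \<beta> - P \<alpha>)\<bar> \<le> (norm w)\<^sup>2 * \<bar>\<alpha> - \<beta>\<bar>"
    using Cauchy_Schwarz_ineq2[of w "P \<beta> - P \<alpha>"] by (simp add: power2_eq_square mult_ac)
  moreover have "root_fun h D u x \<alpha> - root_fun h D u x \<beta> = w \<bullet> (P \<beta> - P \<alpha>) + (\<alpha> - \<beta>)"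
    unfolding root_fun_eq w_def[symmetric] P_def[symmetric] by (simp add: inner_diff_right)
  ultimately have "\<bar>root_fun h D u x \<alpha> - root_fun h D u x \<beta>\<bar> \<le> (1 + (norm w)\<^sup>2) * \<bar>\<alpha> - \<beta>\<bar>"
    by (simp add: distrib_right)
  then show "dist (root_fun h D u x \<alpha>) (root_fun h D u x \<beta>)
      \<le> (1 + (\<Sum>i\<in>UNIV. (u $ i)\<^sup>2 / D $ i $ i)) * dist \<alpha> \<beta>"
    unfolding w_def norm_diag_powr_neg_half dist_real_def .
next
  show "0 \<le> 1 + (\<Sum>i\<in>UNIV. (u $ i)\<^sup>2 / D $ i $ i)"
    by (simp flip: norm_diag_powr_neg_half)
qed

lemma root_fun_has_root: "\<exists>\<alpha>. root_fun h D u x \<alpha> = 0"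
proof -
  define r where "r = root_fun h D u x 0"
  have cont: "continuous_on {-\<bar>r\<bar>..\<bar>r\<bar>} (root_fun h D u x)"
    using lipschitz_on_continuous_on[OF lipschitz_root_fun] continuous_on_subset by blast
  \<comment> \<open>Slope at least \<open>1\<close> forces a sign change within distance \<open>\<bar>r\<bar>\<close> of \<open>0\<close>.\<close>
  have "root_fun h D u x (-\<bar>r\<bar>) \<le> 0" "0 \<le> root_fun h D u x \<bar>r\<bar>"
    using root_fun_slope_ge_1[of "-\<bar>r\<bar>" 0] root_fun_slope_ge_1[of 0 "\<bar>r\<bar>"]
    by (auto simp: r_def)
  then show ?thesis using IVT'[OF _ _ _ cont] by auto
qed

text \<open>The subgradient inequality of \<open>h \<circ> D\<^sup>-\<^sup>1\<^sup>/\<^sup>2\<close> at its proximal point \<open>q\<close>, transported by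
  \<open>D\<^sup>-\<^sup>1\<^sup>/\<^sup>2\<close>, says that \<open>D (x - z) - \<alpha> u\<close> is a subgradient of \<open>h\<close> at \<open>z = D\<^sup>-\<^sup>1\<^sup>/\<^sup>2 q\<close>. The root
  condition is exactly \<open>- \<alpha> = \<langle>u, x - z\<rangle>\<close>, which turns this subgradient into
  \<open>(D + u u\<^sup>T) (x - z)\<close>, the optimality condition for the metric \<open>D + u u\<^sup>T\<close>.\<close>

lemma prox_mat_rank_one_update:
  assumes root: "root_fun h D u x \<alpha> = 0"
  shows "prox_mat (D + (columnvector u :: real^1^'n) ** rowvector u) h x =
    diag_powr D (-1/2) *v prox (h \<circ> (*v) (diag_powr D (-1/2)))
      (diag_powr D (1/2) *v x - \<alpha> *\<^sub>R (diag_powr D (-1/2) *v u))"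
proof -
  let ?S = "diag_powr D (-1/2)" and ?T = "diag_powr D (1/2)"
  define V where "V = D + (columnvector u :: real^1^'n) ** rowvector u"
  define y where "y = ?T *v x - \<alpha> *\<^sub>R (?S *v u)"
  define q where "q = prox (h \<circ> (*v) ?S) y"
  define z where "z = ?S *v q"
  have V: "V *v a = D *v a + (u \<bullet> a) *\<^sub>R u" for a
    by (simp add: V_def rank_one_update_mult_vec)
  have D_inner: "(D *v a) \<bullet> b = (?T *v a) \<bullet> (?T *v b)" for a b
    by (simp add: diag_powr_inner flip: diag_powr_half_half)
  have sym: "(V *v a) \<bullet> b = a \<bullet> (V *v b)" for a b
    using D_inner[of a b] D_inner[of b a]
    by (simp add: V inner_add_left inner_add_right inner_commute)
  have form: "a \<bullet> (V *v a) = (norm (?T *v a))\<^sup>2 + (u \<bullet> a)\<^sup>2" for a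
    using D_inner[of a a]
    by (simp add: V inner_add_right inner_commute power2_norm_eq_inner power2_eq_square[of "a \<bullet> u"])
  have pos: "a \<bullet> (V *v a) > 0" if "a \<noteq> 0" for a
  proof -
    have "?T *v a \<noteq> 0"
      using that diag_powr_cancel(1)[of a] by auto
    then show ?thesis by (simp add: form add_pos_nonneg)
  qed
  have \<alpha>: "u \<bullet> (x - z) = -\<alpha>"
    using root by (simp add: root_fun_def rescaled_shift z_def q_def y_def)
  have Tq: "q = ?T *v z" unfolding z_def by (rule diag_powr_cancel(2)[symmetric])
  have "?T *v (y - q) = D *v (x - z) - \<alpha> *\<^sub>R u"
    unfolding y_def Tq matrix_vector_mult_diff_distrib matrix_vector_mult_scaleR
      diag_powr_cancel(2) diag_powr_half_half by simp
  also have "\<dots> = V *v (x - z)" by (simp add: V \<alpha>)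
  finally have Vxz: "?T *v (y - q) = V *v (x - z)" .
  have sub: "h z + ereal ((V *v (x - z)) \<bullet> (w - z)) \<le> h w" for w
  proof -
    have "(y - q) \<bullet> (?T *v w - q) = (V *v (x - z)) \<bullet> (w - z)"
      unfolding Vxz[symmetric] diag_powr_inner matrix_vector_mult_diff_distrib[of ?T w z]
      by (simp flip: Tq)
    then show ?thesis
      using prox_subgradient(2)[OF Gamma0_rescaled, of y "?T *v w"]
      by (simp only: q_def[symmetric] z_def[symmetric] comp_apply diag_powr_cancel(1))
  qed
  have fin: "\<bar>h z\<bar> \<noteq> \<infinity>"
    using prox_subgradient(1)[OF Gamma0_rescaled, of y] by (simp add: q_def z_def)
  have "(norm_mat V a)\<^sup>2 = a \<bullet> (V *v a)" for a
    by (simp add: norm_mat_def form)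
  then have "prox_mat V h x = z"
    unfolding prox_mat_def
    by (simp only:)
      (rule subgradient_imp_unique_minimizer[OF matrix_vector_mul_linear sym pos fin sub])
  then show ?thesis by (simp add: V_def z_def q_def y_def)
qed

end

theorem theorem7:
  fixes h :: "real^'n \<Rightarrow> ereal"
    and D V :: "real^'n^'n"
    and u x :: "real^'n"
  assumes "h \<in> Gamma0"
    and "\<And>i j. i \<noteq> j \<Longrightarrow> D $ i $ j = 0"
    and "\<And>i. D $ i $ i > 0"
    and "V = D + (columnvector u :: real^1^'n) ** rowvector u"
  shows "(\<exists>\<alpha>s. root_fun h D u x \<alpha>s = 0 \<and>
            (\<forall>\<beta>. root_fun h D u x \<beta> = 0 \<longrightarrow> \<beta> = \<alpha>s) \<and>
            (let v = \<alpha>s *\<^sub>R (diag_powr D (-1/2) *v u)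
             in prox_mat V h x =
                  diag_powr D (-1/2) *v
                    prox (h \<circ> (*v) (diag_powr D (-1/2))) (diag_powr D (1/2) *v x - v))) \<and>
         (1 + (\<Sum>i\<in>UNIV. (u $ i)\<^sup>2 / D $ i $ i))-lipschitz_on UNIV (root_fun h D u x) \<and>
         strict_mono (root_fun h D u x)"
proof -
  obtain \<alpha>s where root: "root_fun h D u x \<alpha>s = 0"
    using root_fun_has_root[OF assms(1-3)] by blast
  have mono: "strict_mono (root_fun h D u x)"
    by (rule strict_mono_root_fun[OF assms(1-3)])
  then have "\<forall>\<beta>. root_fun h D u x \<beta> = 0 \<longrightarrow> \<beta> = \<alpha>s"
    using root by (metis strict_mono_eq)
  with root mono lipschitz_root_fun[OF assms(1-3)] prox_mat_rank_one_update[OF assms(1-3) root]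
  show ?thesis unfolding Let_def assms(4) by blast
qed

end
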